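(* Let $K$ be a finite simplicial complex with a position function $v:K_0\to\mathbb{R}^d$, let $F:\mathcal{D}\to\mathcal{B}$ be a feature map with a labeled decomposition $\hat F:\hat{\mathcal{D}}_K\to\mathcal{B}^{S(K)}$, and let $g:\mathcal{B}\to\mathbb{R}$ be a linear functional. For $\sigma\in K$ and $c\in\mathcal{C}$ let $\bar f_\sigma=g\circ\bar F_\sigma\circ\hat\alpha:\mathbb{R}^m\to\mathbb{R}$ and $\tilde f_c=g\circ\tilde F_c\circ\hat\alpha:\mathbb{R}^m\to\mathbb{R}$, with $\bar F$, $\tilde F$, $\hat\alpha$ as defined in the context. Let $\varepsilon$ be a (nondegenerate) Gaussian random variable in $\mathbb{R}^m$ with mean $0$, and let $\kappa$ denote its density. Then for all $w\in\mathbb{R}^m$, all $\sigma\in K$ and all $c\in\mathcal{C}$ for which the integrals defining the convolutions exist, $$E(\bar f_\sigma(w+\varepsilon))=(\bar f_\sigma*\kappa)(w)\quad\text{and}\quad E(\tilde f_c(w+\varepsilon))=(\tilde f_c*\kappa)(w),$$ where $(h*\kappa)(w)=\int_{\mathbb{R}^m}h(w-x)\kappa(x)\,dx$.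
   Context: Chains. $K$ is a finite abstract simplicial complex: a collection of nonempty subsets of a finite set, closed under taking nonempty subsets and containing all singletons; $K_i$ is the set of simplices of cardinality $i+1$. $S(K)$ is the $\mathbb{Z}/2$-vector space with basis $K$; its elements (chains) are identified with subsets of $K$, and $\|\gamma\|_1$ is the number of simplices in $\gamma$. Persistence. For a total order $\le$ on $K$ extending inclusion $\subseteq$ (a linear extension), the boundary matrix $D$ over $\mathbb{Z}/2$ has rows and columns indexed by $K$ in the order $\le$, with $D_{\sigma\tau}=1$ iff $\sigma\subset\tau$ and $|\sigma|=|\tau|-1$. A matrix $R$ is reduced if distinct nonzero columns have different largest row indices of nonzero entries. A persistence algorithm $\mathcal{A}$ assigns to each boundary matrix $D$ a decomposition $R=DV$ with $R$ reduced and $V$ upper triangular with ones on the diagonal. A birth-death pair is a pair $(\sigma,\tau)$ such that $\sigma$ is the largest row index of a nonzero entry in column $\tau$ of $R$. Each birth-death pair has four associated chains: the birth simplex $\sigma$, the death simplex $\tau$, the representative cycle (sum of all $\rho$ with $R_{\rho\tau}\ne0$) and the bounding chain (sum of all $\rho$ with $V_{\rho\tau}\neq0$). Fix one of these four kinds of chain as the label of birth-death pairs. Diagrams. $\mathcal{D}$ is the set of persistence diagrams, i.e. finite formal sums (multisets) $\sum_i(b_i,d_i)$ with $b_i\le d_i$ real. A labeled persistence diagram is a finite formal sum $\sum_i(b_i,d_i,\ell_i)$ with $b_i\le d_i$; $\hat{\mathcal{D}}_K$ is the set of those arising from $K$, including the empty one $0$, with labels in $S(K)$. $\varphi$ is the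 map forgetting labels. Weights. A weight on $K$ is a function $w:K\to\mathbb{R}$ with $w(\sigma)\le w(\tau)$ whenever $\sigma\subseteq\tau$; $W\subseteq\mathbb{R}^K$ is the set of weights. Fix a persistence algorithm $\mathcal{A}$ and a linear extension $\trianglelefteq$ of $\subseteq$. For $w\in W$, order $K$ by: $\sigma\le_w\tau$ iff $w(\sigma)<w(\tau)$, or $w(\sigma)=w(\tau)$ and $\sigma\trianglelefteq\tau$. Then $\hat\alpha(w)=\sum(w(\sigma),w(\tau),\gamma)$, summed over birth-death pairs $(\sigma,\tau)$ obtained by applying $\mathcal{A}$ to $(K,\le_w)$, where $\gamma$ is the label of the pair. Fix $A\subseteq\mathbb{R}^m$ and $\psi:A\to W$; define $\hat\alpha:\mathbb{R}^m\to\hat{\mathcal{D}}_K$ by $\hat\alpha(a)=\hat\alpha(\psi(a))$ for $a\in A$ and $\hat\alpha(a)=0$ (empty diagram) for $a\notin A$. Feature maps. $\mathcal{B}$ is a separable real Banach space. A feature map is a function $F:\mathcal{D}\to\mathcal{B}$. A labeled decomposition of $F$ is a map $\hat F=(\hat F_\gamma)_{\gamma\in S(K)}:\hat{\mathcal{D}}_K\to\mathcal{B}^{S(K)}$ with $\sum_{\gamma\in S(K)}\hat F_\gamma(\hat a)=F(\varphi(\hat a))$ for all $\hat a\in\hat{\mathcal{D}}_K$. The simplex distribution is $\bar F:\hat{\mathcal{D}}_K\to\mathcal{B}^K$, $\bar F_\sigma(\hat a)=\sum_{\gamma\ni\sigma}\hat F_\gamma(\hat a)/\|\gamma\|_1$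 (sum over chains containing $\sigma$). For the position function $v:K_0\to\mathbb{R}^d$ ($d\ge1$), $|\sigma|$ is the convex hull of $v(\sigma)$, $d_\sigma$ is the dimension of $|\sigma|$, and $|K|=\bigcup_\sigma|\sigma|$. Given a partition of $\mathbb{R}^d$ into translates of a half-open cube $[0,s)^d$ ($s>0$), $\mathcal{C}$ is the finite set of translates that meet $|K|$. The pixel/voxel distribution is $\tilde F:\hat{\mathcal{D}}_K\to\mathcal{B}^{\mathcal{C}}$, $\tilde F_c(\hat a)=\sum_{\sigma\in K}\frac{\operatorname{vol}_{d_\sigma}(|\sigma|\cap c)}{\operatorname{vol}_{d_\sigma}(|\sigma|)}\bar F_\sigma(\hat a)$, where $\operatorname{vol}_k$ is $k$-dimensional volume ($\operatorname{vol}_0$ is counting). Standing convention: the functions $\bar f_\sigma$, $\tilde f_c$ are Borel measurable. *)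

theory Defs
  imports "HOL-Probability.Probability" "HOL-Library.Z2"
begin

section \<open>Simplicial complexes and persistence\<close>

definition abstract_simplicial_complex :: "'v set set \<Rightarrow> bool" where
  "abstract_simplicial_complex K \<longleftrightarrow>
    (\<exists>V. finite V \<and> K \<subseteq> Pow V - {{}} \<and> (\<forall>x\<in>V. {x} \<in> K) \<and>
         (\<forall>\<sigma>\<in>K. \<forall>\<rho>. \<rho> \<subseteq> \<sigma> \<and> \<rho> \<noteq> {} \<longrightarrow> \<rho> \<in> K))"

definition linear_extension :: "'v set set \<Rightarrow> 'v set rel \<Rightarrow> bool" where
  "linear_extension K le \<longleftrightarrow>
    linear_order_on K le \<and> (\<forall>\<sigma>\<in>K. \<forall>\<tau>\<in>K. \<sigma> \<subseteq> \<tau> \<longrightarrow> (\<sigma>, \<tau>) \<in> le)"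

text \<open>Matrices over \<open>\<int>/2\<close> (type \<open>bit\<close>) with rows and columns indexed by simplices; only the
  entries with both indices in the complex are meaningful.\<close>

type_synonym 'v simplex_matrix = "'v set \<Rightarrow> 'v set \<Rightarrow> bit"

definition boundary_matrix :: "'v simplex_matrix" where
  "boundary_matrix \<sigma> \<tau> = (if \<sigma> \<subset> \<tau> \<and> Suc (card \<sigma>) = card \<tau> then 1 else 0)"

text \<open>\<open>is_low K le R \<sigma> \<tau>\<close>: the largest row index (with respect to \<open>le\<close>) of a nonzero entry in
  column \<open>\<tau>\<close> of \<open>R\<close> is \<open>\<sigma>\<close>.\<close>

definition is_low ::
  "'v set set \<Rightarrow> 'v set rel \<Rightarrow> 'v simplex_matrix \<Rightarrow> 'v set \<Rightarrow> 'v set \<Rightarrow> bool" where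
  "is_low K le R \<sigma> \<tau> \<longleftrightarrow>
    \<sigma> \<in> K \<and> R \<sigma> \<tau> \<noteq> 0 \<and> (\<forall>\<rho>\<in>K. R \<rho> \<tau> \<noteq> 0 \<longrightarrow> (\<rho>, \<sigma>) \<in> le)"

definition reduced :: "'v set set \<Rightarrow> 'v set rel \<Rightarrow> 'v simplex_matrix \<Rightarrow> bool" where
  "reduced K le R \<longleftrightarrow>
    (\<forall>\<tau>\<in>K. \<forall>\<tau>'\<in>K. \<forall>\<sigma>\<in>K. is_low K le R \<sigma> \<tau> \<and> is_low K le R \<sigma> \<tau>' \<longrightarrow> \<tau> = \<tau>')"

definition unit_upper_triangular :: "'v set set \<Rightarrow> 'v set rel \<Rightarrow> 'v simplex_matrix \<Rightarrow> bool" where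
  "unit_upper_triangular K le V \<longleftrightarrow>
    (\<forall>\<sigma>\<in>K. V \<sigma> \<sigma> = 1) \<and> (\<forall>\<sigma>\<in>K. \<forall>\<tau>\<in>K. V \<sigma> \<tau> \<noteq> 0 \<longrightarrow> (\<sigma>, \<tau>) \<in> le)"

text \<open>The boundary matrix, with its ordered rows and columns, is given by the pair of the complex
  and the order, so this pair is the input of an algorithm; the output is the pair \<open>(R, V)\<close>.\<close>

type_synonym 'v algorithm =
  "'v set set \<Rightarrow> 'v set rel \<Rightarrow> 'v simplex_matrix \<times> 'v simplex_matrix"

definition persistence_algorithm :: "'v algorithm \<Rightarrow> bool" where
  "persistence_algorithm alg \<longleftrightarrow>
    (\<forall>K le. abstract_simplicial_complex K \<and> linear_extension K le \<longrightarrow>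
      (case alg K le of (R, V) \<Rightarrow>
        (\<forall>\<sigma>\<in>K. \<forall>\<tau>\<in>K. R \<sigma> \<tau> = (\<Sum>\<rho>\<in>K. boundary_matrix \<sigma> \<rho> * V \<rho> \<tau>)) \<and>
        reduced K le R \<and> unit_upper_triangular K le V))"

definition birth_death_pairs ::
  "'v algorithm \<Rightarrow> 'v set set \<Rightarrow> 'v set rel \<Rightarrow> ('v set \<times> 'v set) set" where
  "birth_death_pairs alg K le =
    {(\<sigma>, \<tau>). \<sigma> \<in> K \<and> \<tau> \<in> K \<and> is_low K le (fst (alg K le)) \<sigma> \<tau>}"

text \<open>A chain over \<open>\<int>/2\<close> is identified with the set of its simplices, so that \<open>S(K)\<close> is
  \<open>Pow K\<close> and \<open>\<parallel>\<gamma>\<parallel>\<^sub>1\<close> is \<open>card \<gamma>\<close>.\<close>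

datatype label_kind = Birth_Simplex | Death_Simplex | Representative_Cycle | Bounding_Chain

fun pair_label ::
  "label_kind \<Rightarrow> 'v algorithm \<Rightarrow> 'v set set \<Rightarrow> 'v set rel \<Rightarrow> 'v set \<Rightarrow> 'v set \<Rightarrow> 'v set set" where
  "pair_label Birth_Simplex alg K le \<sigma> \<tau> = {\<sigma>}"
| "pair_label Death_Simplex alg K le \<sigma> \<tau> = {\<tau>}"
| "pair_label Representative_Cycle alg K le \<sigma> \<tau> = {\<rho>\<in>K. fst (alg K le) \<rho> \<tau> \<noteq> 0}"
| "pair_label Bounding_Chain alg K le \<sigma> \<tau> = {\<rho>\<in>K. snd (alg K le) \<rho> \<tau> \<noteq> 0}"

section \<open>Weights and (labeled) persistence diagrams\<close>

definition weights :: "'v set set \<Rightarrow> ('v set \<Rightarrow> real) set" where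
  "weights K = {w. \<forall>\<sigma>\<in>K. \<forall>\<tau>\<in>K. \<sigma> \<subseteq> \<tau> \<longrightarrow> w \<sigma> \<le> w \<tau>}"

definition weight_order :: "'v set set \<Rightarrow> 'v set rel \<Rightarrow> ('v set \<Rightarrow> real) \<Rightarrow> 'v set rel" where
  "weight_order K ext w =
    {(\<sigma>, \<tau>). \<sigma> \<in> K \<and> \<tau> \<in> K \<and> (w \<sigma> < w \<tau> \<or> (w \<sigma> = w \<tau> \<and> (\<sigma>, \<tau>) \<in> ext))}"

type_synonym diagram = "(real \<times> real) multiset"
type_synonym 'v labeled_diagram = "(real \<times> real \<times> 'v set set) multiset"

definition forget_labels :: "'v labeled_diagram \<Rightarrow> diagram" where
  "forget_labels D = image_mset (\<lambda>(b, d, \<gamma>). (b, d)) D"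

definition weight_diagram ::
  "label_kind \<Rightarrow> 'v algorithm \<Rightarrow> 'v set set \<Rightarrow> 'v set rel \<Rightarrow> ('v set \<Rightarrow> real) \<Rightarrow> 'v labeled_diagram" where
  "weight_diagram kind alg K ext w =
    (let le = weight_order K ext w in
      image_mset (\<lambda>(\<sigma>, \<tau>). (w \<sigma>, w \<tau>, pair_label kind alg K le \<sigma> \<tau>))
        (mset_set (birth_death_pairs alg K le)))"

text \<open>The labeled diagrams arising from \<open>K\<close>, from any weight, tie-breaking linear extension and
  persistence algorithm, for the given kind of label.\<close>

definition labeled_diagrams :: "label_kind \<Rightarrow> 'v set set \<Rightarrow> 'v labeled_diagram set" where
  "labeled_diagrams kind K =
    insert {#} {weight_diagram kind alg K ext w | alg ext w.
      persistence_algorithm alg \<and> linear_extension K ext \<and> w \<in> weights K}"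

definition extended_diagram ::
  "label_kind \<Rightarrow> 'v algorithm \<Rightarrow> 'v set set \<Rightarrow> 'v set rel \<Rightarrow>
    (real ^ 'm) set \<Rightarrow> (real ^ 'm \<Rightarrow> 'v set \<Rightarrow> real) \<Rightarrow> real ^ 'm \<Rightarrow> 'v labeled_diagram" where
  "extended_diagram kind alg K ext A \<psi> a =
    (if a \<in> A then weight_diagram kind alg K ext (\<psi> a) else {#})"

section \<open>Decompositions of feature maps\<close>

definition labeled_decomposition ::
  "label_kind \<Rightarrow> 'v set set \<Rightarrow> (diagram \<Rightarrow> 'b::real_normed_vector) \<Rightarrow>
    ('v set set \<Rightarrow> 'v labeled_diagram \<Rightarrow> 'b) \<Rightarrow> bool" where
  "labeled_decomposition kind K F Fh \<longleftrightarrow>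
    (\<forall>D\<in>labeled_diagrams kind K. (\<Sum>\<gamma>\<in>Pow K. Fh \<gamma> D) = F (forget_labels D))"

definition simplex_distribution ::
  "'v set set \<Rightarrow> ('v set set \<Rightarrow> 'v labeled_diagram \<Rightarrow> 'b::real_normed_vector) \<Rightarrow>
    'v set \<Rightarrow> 'v labeled_diagram \<Rightarrow> 'b" where
  "simplex_distribution K Fh \<sigma> D = (\<Sum>\<gamma> | \<gamma> \<in> Pow K \<and> \<sigma> \<in> \<gamma>. Fh \<gamma> D /\<^sub>R real (card \<gamma>))"

definition geometric_simplex :: "('v \<Rightarrow> real ^ 'd) \<Rightarrow> 'v set \<Rightarrow> (real ^ 'd) set" where
  "geometric_simplex v \<sigma> = convex hull (v ` \<sigma>)"

definition simplex_dim :: "('v \<Rightarrow> real ^ 'd) \<Rightarrow> 'v set \<Rightarrow> nat" where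
  "simplex_dim v \<sigma> = nat (aff_dim (geometric_simplex v \<sigma>))"

definition half_open_cube :: "real \<Rightarrow> (real ^ 'd) set" where
  "half_open_cube s = {x. \<forall>i. 0 \<le> x $ i \<and> x $ i < s}"

definition cube_partition :: "real \<Rightarrow> (real ^ 'd) set set \<Rightarrow> bool" where
  "cube_partition s P \<longleftrightarrow>
    partition_on UNIV P \<and> (\<forall>c\<in>P. \<exists>t. c = (\<lambda>x. t + x) ` half_open_cube s)"

definition voxels :: "'v set set \<Rightarrow> ('v \<Rightarrow> real ^ 'd) \<Rightarrow> (real ^ 'd) set set \<Rightarrow> (real ^ 'd) set set" where
  "voxels K v P = {c\<in>P. c \<inter> (\<Union>\<sigma>\<in>K. geometric_simplex v \<sigma>) \<noteq> {}}"

text \<open>The \<open>k\<close>-dimensional volume of a set lying in a \<open>k\<close>-dimensional affine subspace: its Lebesgue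
  measure in the coordinates given by an origin \<open>p\<close> and an orthonormal frame \<open>e\<close>. By invariance of
  Lebesgue measure under isometries the value does not depend on the choice of \<open>p\<close> and \<open>e\<close>. For sets
  contained in no such subspace the definition is meaningless (unless \<open>k = 0\<close>).\<close>

definition k_volume :: "nat \<Rightarrow> (real ^ 'd) set \<Rightarrow> real" where
  "k_volume k S =
    (if k = 0 then real (card S) else
      (let (p, e) = (SOME (p, e :: nat \<Rightarrow> real ^ 'd).
             (\<forall>i<k. \<forall>j<k. e i \<bullet> e j = (if i = j then 1 else 0)) \<and>
             S \<subseteq> (\<lambda>y. p + y) ` span (e ` {..<k}));
           L = (\<Pi>\<^sub>M i\<in>{..<k}. (lborel :: real measure))
       in measure L {x\<in>space L. p + (\<Sum>i<k. x i *\<^sub>R e i) \<in> S}))"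

definition voxel_distribution ::
  "'v set set \<Rightarrow> ('v \<Rightarrow> real ^ 'd) \<Rightarrow>
    ('v set set \<Rightarrow> 'v labeled_diagram \<Rightarrow> 'b::real_normed_vector) \<Rightarrow>
    (real ^ 'd) set \<Rightarrow> 'v labeled_diagram \<Rightarrow> 'b" where
  "voxel_distribution K v Fh c D =
    (\<Sum>\<sigma>\<in>K. (k_volume (simplex_dim v \<sigma>) (geometric_simplex v \<sigma> \<inter> c) /
            k_volume (simplex_dim v \<sigma>) (geometric_simplex v \<sigma>)) *\<^sub>R simplex_distribution K Fh \<sigma> D)"

section \<open>Gaussian noise and convolution\<close>

definition positive_definite :: "real ^ 'm ^ 'm \<Rightarrow> bool" where
  "positive_definite Q \<longleftrightarrow> transpose Q = Q \<and> (\<forall>x. x \<noteq> 0 \<longrightarrow> 0 < x \<bullet> (Q *v x))"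

text \<open>Density of the centered normal distribution on \<open>\<real>\<^sup>m\<close> with covariance matrix \<open>Q\<close>.\<close>

definition centered_gaussian_density :: "real ^ 'm ^ 'm \<Rightarrow> real ^ 'm \<Rightarrow> real" where
  "centered_gaussian_density Q x =
    exp (- (x \<bullet> (matrix_inv Q *v x)) / 2) / sqrt ((2 * pi) ^ CARD('m) * det Q)"

definition convolution_exists ::
  "(real ^ 'm \<Rightarrow> real) \<Rightarrow> (real ^ 'm \<Rightarrow> real) \<Rightarrow> real ^ 'm \<Rightarrow> bool" where
  "convolution_exists h \<kappa> w \<longleftrightarrow> integrable lborel (\<lambda>x. h (w - x) * \<kappa> x)"

definition density_convolution :: "(real ^ 'm \<Rightarrow> real) \<Rightarrow> (real ^ 'm \<Rightarrow> real) \<Rightarrow> real ^ 'm \<Rightarrow> real" where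
  "density_convolution h \<kappa> w = (\<integral>x. h (w - x) * \<kappa> x \<partial>lborel)"

end

theory Submission
  imports Defs
begin

text \<open>An even density turns \<open>h(w - x)\<close> into \<open>h(w + x)\<close> under the reflection \<open>x \<mapsto> -x\<close>, which preserves
  Lebesgue measure; the expectation is then the convolution. The Gaussian density is even because
  its exponent is a quadratic form.\<close>

text \<open>The reflection is the affine map with factor -1 and shift 0; its Jacobian factor, a
  power of |-1|, is 1.\<close>

lemma lborel_distr_uminus_euclidean:
  "distr lborel borel (uminus :: 'a::euclidean_space \<Rightarrow> 'a) = lborel"
proof -
  have "(lborel :: 'a measure) = density (distr lborel borel uminus) (\<lambda>_. 1)"
    using lborel_affine[of "-1" "0::'a"] by (simp add: uminus_add_conv_diff[symmetric] ennreal_1 del: density_1)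
  then show ?thesis
    by (simp add: density_1)
qed

text \<open>With \<open>h\<close> arbitrary, one result serves both the simplex and the voxel
  functions. Integrability is a separate claim because a Bochner integral defaults to 0, so the
  equality alone would not show that the expectation exists.\<close>

lemma
  fixes h :: "real ^ 'm \<Rightarrow> real"
  assumes X: "distributed M lborel X f"
    and f_nonneg: "\<And>x. 0 \<le> f x"
    and f_even: "\<And>x. f (- x) = f x"
    and h: "h \<in> borel_measurable borel"
    and conv: "convolution_exists h f w"
  shows integrable_noise_of_convolution_exists: "integrable M (\<lambda>\<omega>. h (w + X \<omega>))"
    and expectation_noise_eq_convolution: "(\<integral>\<omega>. h (w + X \<omega>) \<partial>M) = density_convolution h f w"
proof -
  have f_meas: "f \<in> borel_measurable borel"
    using distributed_real_measurable[OF _ X] f_nonneg by simp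
  have hw: "(\<lambda>x. h (w + x)) \<in> borel_measurable lborel"
    and meas: "(\<lambda>x. f x * h (w + x)) \<in> borel_measurable borel"
    using h f_meas by measurable
  \<comment> \<open>Pulled back along the reflection, the integrand becomes the one in
    \<open>conv\<close>, since \<open>f\<close> is even.\<close>
  have "integrable (distr lborel borel uminus) (\<lambda>x. f x * h (w + x))"
    using conv meas
    by (simp add: convolution_exists_def integrable_distr_eq f_even mult.commute)
  then show "integrable M (\<lambda>\<omega>. h (w + X \<omega>))"
    using distributed_integrable[OF X hw] f_nonneg by (simp add: lborel_distr_uminus_euclidean)
  have "(\<integral>\<omega>. h (w + X \<omega>) \<partial>M) = (\<integral>x. f x * h (w + x) \<partial>lborel)"
    using distributed_integral[OF X hw] f_nonneg by simp
  also have "\<dots> = (\<integral>x. f x * h (w + x) \<partial>distr lborel borel uminus)"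
    by (simp add: lborel_distr_uminus_euclidean)
  also have "\<dots> = density_convolution h f w"
    using meas by (simp add: density_convolution_def integral_distr f_even mult.commute)
  finally show "(\<integral>\<omega>. h (w + X \<omega>) \<partial>M) = density_convolution h f w" .
qed

lemma centered_gaussian_density_even:
  "centered_gaussian_density Q (- x) = centered_gaussian_density Q x"
proof -
  \<comment> \<open>Distributivity is applied to the difference \<open>0 - x\<close>; the two signs
    cancel in the inner product.\<close>
  have "matrix_inv Q *v (- x) = - (matrix_inv Q *v x)"
    using matrix_vector_mult_diff_distrib[of "matrix_inv Q" 0 x] by simp
  then show ?thesis
    by (simp add: centered_gaussian_density_def)
qed

text \<open>The sign of the normalizing constant does not depend on the point, and a nowhere positive
  function is not a probability density; this spares us the proof that \<open>det Q > 0\<close>.\<close>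

lemma centered_gaussian_density_nonneg:
  fixes Q :: "real ^ 'm ^ 'm"
  assumes "prob_space M" and X: "distributed M lborel X (centered_gaussian_density Q)"
  shows "0 \<le> centered_gaussian_density Q x"
proof (rule ccontr)
  assume "\<not> ?thesis"
  \<comment> \<open>The numerator is an exponential, so the denominator must be negative; this can
    happen because \<open>sqrt\<close> is extended to negative arguments as an odd function.\<close>
  then have "sqrt ((2 * pi) ^ CARD('m) * det Q) < 0"
    by (auto simp: centered_gaussian_density_def zero_le_divide_iff)
  \<comment> \<open>The denominator is the same at every \<open>y\<close>, and
    \<open>ennreal\<close> sends negative reals to 0.\<close>
  then have "ennreal (centered_gaussian_density Q y) = 0" for y
    unfolding centered_gaussian_density_def
    by (intro ennreal_neg divide_nonneg_nonpos) auto
  \<comment> \<open>This preimage is all of \<open>space M\<close>, which has mass 1.\<close>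
  then have "emeasure M (X -` space lborel \<inter> space M) = 0"
    using distributed_emeasure[OF X, of "space lborel"] by simp
  then show False
    using prob_space.emeasure_space_1[OF assms(1)] by simp
qed

theorem mainTheorem4:
  fixes K :: "'v set set"
    and v :: "'v \<Rightarrow> real ^ 'd"
    and F :: "diagram \<Rightarrow> 'b::{banach, second_countable_topology}"
    and Fh :: "'v set set \<Rightarrow> 'v labeled_diagram \<Rightarrow> 'b"
    and g :: "'b \<Rightarrow> real"
    and kind :: label_kind
    and alg :: "'v algorithm"
    and ext :: "'v set rel"
    and A :: "(real ^ 'm) set"
    and \<psi> :: "real ^ 'm \<Rightarrow> 'v set \<Rightarrow> real"
    and s :: real
    and P :: "(real ^ 'd) set set"
    and M :: "'\<omega> measure"
    and \<epsilon> :: "'\<omega> \<Rightarrow> real ^ 'm"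
    and Q :: "real ^ 'm ^ 'm"
    and \<kappa> :: "real ^ 'm \<Rightarrow> real"
    and ah :: "real ^ 'm \<Rightarrow> 'v labeled_diagram"
    and fbar :: "'v set \<Rightarrow> real ^ 'm \<Rightarrow> real"
    and ftilde :: "(real ^ 'd) set \<Rightarrow> real ^ 'm \<Rightarrow> real"
  assumes "abstract_simplicial_complex K"
    and "persistence_algorithm alg"
    and "linear_extension K ext"
    and "\<And>a. a \<in> A \<Longrightarrow> \<psi> a \<in> weights K"
    and "labeled_decomposition kind K F Fh"
    and "linear g"
    and "s > 0" and "cube_partition s P"
    and ah: "ah = extended_diagram kind alg K ext A \<psi>"
    and fbar: "\<And>\<sigma>. fbar \<sigma> = g \<circ> simplex_distribution K Fh \<sigma> \<circ> ah"
    and ftilde: "\<And>c. ftilde c = g \<circ> voxel_distribution K v Fh c \<circ> ah"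
    and "\<And>\<sigma>. \<sigma> \<in> K \<Longrightarrow> fbar \<sigma> \<in> borel_measurable borel"
    and "\<And>c. c \<in> voxels K v P \<Longrightarrow> ftilde c \<in> borel_measurable borel"
    and "prob_space M"
    and "positive_definite Q"
    and "\<kappa> = centered_gaussian_density Q"
    and "distributed M lborel \<epsilon> \<kappa>"
  shows "\<forall>w. (\<forall>\<sigma>\<in>K. convolution_exists (fbar \<sigma>) \<kappa> w \<longrightarrow>
            integrable M (\<lambda>\<omega>. fbar \<sigma> (w + \<epsilon> \<omega>)) \<and>
            prob_space.expectation M (\<lambda>\<omega>. fbar \<sigma> (w + \<epsilon> \<omega>)) = density_convolution (fbar \<sigma>) \<kappa> w) \<and>
          (\<forall>c\<in>voxels K v P. convolution_exists (ftilde c) \<kappa> w \<longrightarrow>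
            integrable M (\<lambda>\<omega>. ftilde c (w + \<epsilon> \<omega>)) \<and>
            prob_space.expectation M (\<lambda>\<omega>. ftilde c (w + \<epsilon> \<omega>)) = density_convolution (ftilde c) \<kappa> w)"
proof -
  have nonneg: "0 \<le> \<kappa> x" and even: "\<kappa> (- x) = \<kappa> x" for x
    using assms centered_gaussian_density_nonneg[of M \<epsilon> Q] centered_gaussian_density_even[of Q]
    by auto
  note noise = integrable_noise_of_convolution_exists expectation_noise_eq_convolution
  note noise_\<kappa> = noise[OF \<open>distributed M lborel \<epsilon> \<kappa>\<close> nonneg even]
  \<comment> \<open>The two numbered assumptions are the measurability of \<open>fbar\<close> and of
    \<open>ftilde\<close>, required of \<open>h\<close>.\<close>
  show ?thesis
    using noise_\<kappa> assms(12,13) by blast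
qed

end
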